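(* Let $B$ be a nucleation process and $G$ a growth process on $[t_0,T]$, let $t\in[t_0,T]$ and let $\{\Pi_j\}_{j\in\mathbb N}$ be a refinement sequence of $[t_0,t]$. Then, almost surely, $$\lim_{j\to\infty}\delta_H\big(s_{\Pi_j}(t),S_{\Pi_j}(t)\big)=0.$$
   Context: Setting. $\mathfrak X$ is a reflexive Banach space with separable dual; $[t_0,T]\subset\mathbb R$; $(\Omega,\mathfrak F,\{\mathfrak F_t\}_{t\in[t_0,T]},\mathbb P)$ is a filtered complete probability space satisfying the usual conditions. $\mathbb F(\mathfrak X)$ is the family of non-empty closed subsets of $\mathfrak X$. A set-valued map $X$ defined on a measurable space $(E,\mathcal E)$ with values in subsets of $\mathfrak X$ is measurable if $\{e: X(e)\cap O\neq\emptyset\}\in\mathcal E$ for every open $O\subseteq\mathfrak X$. The Hausdorff distance on $\mathbb F(\mathfrak X)$ (possibly $+\infty$) is $\delta_H(A,C)=\max\{\sup_{a\in A}\inf_{c\in C}\|a-c\|,\ \sup_{c\in C}\inf_{a\in A}\|a-c\|\}$. Nucleation process: a map $B:\Omega\times[t_0,T]\to\mathbb F(\mathfrak X)$, $B_t=B(\cdot,t)$, such that $B_t$ is $\mathfrak F_t$-measurable for every $t$, and $B_s\subseteq B_t$ whenever $s<t$. Growth process: a map $G:\Omega\times[t_0,T]\to\mathbb F(\mathfrak X)$ such that for all $(\omega,t)$: $0\in G(\omega,t)$, $G(\omega,t)$ is convex, $G(\omega,t)\subseteq K$ for a fixed non-empty closed bounded set $K\subset\mathfrak X$ (independent of $\omega,t$),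 and $G$ is measurable with respect to the predictable $\sigma$-algebra $\mathcal P$ on $\Omega\times[t_0,T]$, i.e. the $\sigma$-algebra generated by the sets $A\times\{t_0\}$ with $A\in\mathfrak F_{t_0}$ and $A\times(s,t]$ with $A\in\mathfrak F_s$, $(s,t]\subset[t_0,T]$. For $a\le b$, $\int_a^b G(\tau)\,d\tau$ is the random set $\omega\mapsto\int_a^bG(\omega,\tau)\,d\tau$, the Aumann integral with respect to Lebesgue measure: $\{\int_a^b g(\tau)\,d\tau: g \text{ Bochner integrable on }[t_0,T],\ g(\tau)\in G(\omega,\tau)\text{ for a.e. }\tau\}$. Minkowski sum: $A+C=\{a+c:a\in A,c\in C\}$ (with $\emptyset+A=\emptyset$), and $A\oplus C=\overline{A+C}$. A partition of $[t_0,t]$ is $\Pi=(t_i)_{i=0}^n$ with $t_0<t_1<\dots<t_n=t$; its mesh is $|\Pi|=\max_i(t_i-t_{i-1})$. A refinement sequence of $[t_0,t]$ is a sequence of partitions $\{\Pi_j\}_{j\in\mathbb N}$ of $[t_0,t]$ with $|\Pi_j|\to0$ as $j\to\infty$. Put $\Delta B_{t_i}=B_{t_i}\setminus B_{t_{i-1}}^{o}$, where $B^{o}$ is the interior of $B$, and $$s_\Pi(t)=\Big(B_{t_0}\oplus\int_{t_0}^tG(\tau)d\tau\Big)\cup\bigcup_{i=1}^n\Big(\Delta B_{t_i}\oplus\int_{t_i}^tG(\tau)d\tau\Big),$$ $$S_\Pi(t)=\Big(B_{t_0}\oplus\int_{t_0}^tG(\tau)d\tau\Big)\cup\bigcup_{i=1}^n\Big(\Delta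 B_{t_i}\oplus\int_{t_{i-1}}^tG(\tau)d\tau\Big).$$ *)

theory Defs
  imports "HOL-Probability.Probability"
begin

definition bidual_embedding :: "'a::real_normed_vector \<Rightarrow> (('a \<Rightarrow>\<^sub>L real) \<Rightarrow>\<^sub>L real)" where
  "bidual_embedding x = Blinfun (\<lambda>f. blinfun_apply f x)"

lemma bidual_embedding_apply: "blinfun_apply (bidual_embedding x) f = blinfun_apply f x"
  by (simp add: bidual_embedding_def bounded_linear_Blinfun_apply
      bounded_bilinear.bounded_linear_left[OF bounded_bilinear_blinfun_apply])

definition reflexive_space :: "'a::real_normed_vector itself \<Rightarrow> bool" where
  "reflexive_space _ \<longleftrightarrow> surj (bidual_embedding :: 'a \<Rightarrow> (('a \<Rightarrow>\<^sub>L real) \<Rightarrow>\<^sub>L real))"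

definition separable_dual :: "'a::real_normed_vector itself \<Rightarrow> bool" where
  "separable_dual _ \<longleftrightarrow> separable_space (euclidean :: ('a \<Rightarrow>\<^sub>L real) topology)"

text \<open>The infimum over the empty set is \<open>\<infinity>\<close> and the supremum over it is \<open>0\<close>.\<close>

definition hausdorff_distance :: "'a::real_normed_vector set \<Rightarrow> 'a set \<Rightarrow> ennreal" where
  "hausdorff_distance A C =
     max (SUP a\<in>A. INF c\<in>C. ennreal (norm (a - c))) (SUP c\<in>C. INF a\<in>A. ennreal (norm (a - c)))"

definition measurable_set_valued :: "'e measure \<Rightarrow> ('e \<Rightarrow> 'a::topological_space set) \<Rightarrow> bool" where
  "measurable_set_valued N X \<longleftrightarrow> (\<forall>U. open U \<longrightarrow> {e \<in> space N. X e \<inter> U \<noteq> {}} \<in> sets N)"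

text \<open>The time set is \<open>{t0..T}\<close>; the values of the filtration and of all processes at other times
  are irrelevant.\<close>

locale filtered_prob_space = prob_space M + complete_measure M
  for M :: "'w measure" +
  fixes F :: "real \<Rightarrow> 'w measure" and t0 T :: real
  assumes subalgebra_F: "\<And>t. t \<in> {t0..T} \<Longrightarrow> subalgebra M (F t)"
    and F_mono: "\<And>s t. t0 \<le> s \<Longrightarrow> s \<le> t \<Longrightarrow> t \<le> T \<Longrightarrow> sets (F s) \<subseteq> sets (F t)"
    and F_null_sets: "t0 \<le> T \<Longrightarrow> null_sets M \<subseteq> sets (F t0)"
    and F_right_continuous: "\<And>t. t \<in> {t0..<T} \<Longrightarrow> sets (F t) = (\<Inter>s\<in>{t<..T}. sets (F s))"

definition predictable_algebra ::
    "'w measure \<Rightarrow> (real \<Rightarrow> 'w measure) \<Rightarrow> real \<Rightarrow> real \<Rightarrow> ('w \<times> real) measure" where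
  "predictable_algebra M F t0 T = sigma (space M \<times> {t0..T})
     ({A \<times> {t0} | A. A \<in> sets (F t0)} \<union>
      {A \<times> {s<..t} | A s t. A \<in> sets (F s) \<and> t0 \<le> s \<and> s < t \<and> t \<le> T})"

definition nucleation_process ::
    "'w measure \<Rightarrow> (real \<Rightarrow> 'w measure) \<Rightarrow> real \<Rightarrow> real \<Rightarrow> ('w \<Rightarrow> real \<Rightarrow> 'a::real_normed_vector set) \<Rightarrow> bool"
  where
  "nucleation_process M F t0 T B \<longleftrightarrow>
     (\<forall>\<omega>\<in>space M. \<forall>t\<in>{t0..T}. closed (B \<omega> t) \<and> B \<omega> t \<noteq> {}) \<and>
     (\<forall>t\<in>{t0..T}. measurable_set_valued (F t) (\<lambda>\<omega>. B \<omega> t)) \<and>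
     (\<forall>\<omega>\<in>space M. \<forall>s\<in>{t0..T}. \<forall>t\<in>{t0..T}. s < t \<longrightarrow> B \<omega> s \<subseteq> B \<omega> t)"

definition growth_process ::
    "'w measure \<Rightarrow> (real \<Rightarrow> 'w measure) \<Rightarrow> real \<Rightarrow> real \<Rightarrow> ('w \<Rightarrow> real \<Rightarrow> 'a::real_normed_vector set) \<Rightarrow> bool"
  where
  "growth_process M F t0 T G \<longleftrightarrow>
     (\<forall>\<omega>\<in>space M. \<forall>t\<in>{t0..T}. closed (G \<omega> t) \<and> 0 \<in> G \<omega> t \<and> convex (G \<omega> t)) \<and>
     (\<exists>K. K \<noteq> {} \<and> closed K \<and> bounded K \<and> (\<forall>\<omega>\<in>space M. \<forall>t\<in>{t0..T}. G \<omega> t \<subseteq> K)) \<and>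
     measurable_set_valued (predictable_algebra M F t0 T) (\<lambda>(\<omega>, t). G \<omega> t)"

text \<open>Selections are taken over all of \<open>{t0..T}\<close>, also when the integral runs over a subinterval.
  The class \<open>second_countable_topology\<close>, needed for the Bochner integral, amounts to separability,
  which follows from separability of the dual.\<close>

definition aumann_integral ::
    "real \<Rightarrow> real \<Rightarrow> real \<Rightarrow> real \<Rightarrow> (real \<Rightarrow> 'a::{banach,second_countable_topology} set) \<Rightarrow> 'a set" where
  "aumann_integral t0 T a b \<Gamma> =
     {set_lebesgue_integral lebesgue {a..b} g | g.
        set_integrable lebesgue {t0..T} g \<and> (AE \<tau> in lebesgue. \<tau> \<in> {t0..T} \<longrightarrow> g \<tau> \<in> \<Gamma> \<tau>)}"

definition closed_minkowski_sum :: "'a::real_normed_vector set \<Rightarrow> 'a set \<Rightarrow> 'a set"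
    (infixl "\<oplus>\<^sub>M" 65) where
  "A \<oplus>\<^sub>M C = closure (A + C)"

text \<open>A partition \<open>p 0 < \<dots> < p n\<close> is given by \<open>n\<close> and the values of \<open>p\<close> on \<open>{..n}\<close>. For \<open>a = b\<close> the
  only partition is the trivial one with \<open>n = 0\<close>, and its mesh is \<open>0\<close>.\<close>

definition partition_of :: "real \<Rightarrow> real \<Rightarrow> nat \<Rightarrow> (nat \<Rightarrow> real) \<Rightarrow> bool" where
  "partition_of a b n p \<longleftrightarrow> p 0 = a \<and> p n = b \<and> (\<forall>i\<in>{1..n}. p (i - 1) < p i)"

definition mesh :: "nat \<Rightarrow> (nat \<Rightarrow> real) \<Rightarrow> real" where
  "mesh n p = (if n = 0 then 0 else Max ((\<lambda>i. p i - p (i - 1)) ` {1..n}))"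

definition refinement_sequence :: "real \<Rightarrow> real \<Rightarrow> (nat \<Rightarrow> nat) \<Rightarrow> (nat \<Rightarrow> nat \<Rightarrow> real) \<Rightarrow> bool" where
  "refinement_sequence a b n p \<longleftrightarrow>
     (\<forall>j. partition_of a b (n j) (p j)) \<and> (\<lambda>j. mesh (n j) (p j)) \<longlonglongrightarrow> 0"

text \<open>In the two definitions below, \<open>B\<close> and \<open>G\<close> are the paths of the processes for one fixed outcome.\<close>

definition nucleation_increment :: "(real \<Rightarrow> 'a::topological_space set) \<Rightarrow> (nat \<Rightarrow> real) \<Rightarrow> nat \<Rightarrow> 'a set"
  where "nucleation_increment B p i = B (p i) - interior (B (p (i - 1)))"

definition lower_sum :: "real \<Rightarrow> real \<Rightarrow> (real \<Rightarrow> 'a::{banach,second_countable_topology} set) \<Rightarrow>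
    (real \<Rightarrow> 'a set) \<Rightarrow> real \<Rightarrow> nat \<Rightarrow> (nat \<Rightarrow> real) \<Rightarrow> 'a set" where
  "lower_sum t0 T B G t n p =
     (B t0 \<oplus>\<^sub>M aumann_integral t0 T t0 t G) \<union>
     (\<Union>i\<in>{1..n}. nucleation_increment B p i \<oplus>\<^sub>M aumann_integral t0 T (p i) t G)"

definition upper_sum :: "real \<Rightarrow> real \<Rightarrow> (real \<Rightarrow> 'a::{banach,second_countable_topology} set) \<Rightarrow>
    (real \<Rightarrow> 'a set) \<Rightarrow> real \<Rightarrow> nat \<Rightarrow> (nat \<Rightarrow> real) \<Rightarrow> 'a set" where
  "upper_sum t0 T B G t n p =
     (B t0 \<oplus>\<^sub>M aumann_integral t0 T t0 t G) \<union>
     (\<Union>i\<in>{1..n}. nucleation_increment B p i \<oplus>\<^sub>M aumann_integral t0 T (p (i - 1)) t G)"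

end

theory Submission
  imports Defs
begin

text \<open>The argument is pathwise. The two sums differ only in that the integral attached to the
  \<open>i\<close>-th increment starts at \<open>p i\<close> instead of \<open>p (i - 1)\<close>. Integrating one and the same selection
  over both intervals changes the result by at most \<open>c * (p i - p (i - 1))\<close>, where \<open>c\<close> bounds \<open>K\<close>.
  Hence the Hausdorff distance is at most \<open>c\<close> times the mesh, for every outcome.\<close>

text \<open>The slack \<open>e\<close> is there because points of a closure, and infima, are only
  approached. It vanishes at the end, since a bound by \<open>d + e\<close> for all positive
  \<open>e\<close> gives a bound by \<open>d\<close>.\<close>

lemma hausdorff_distance_le:
  fixes A C :: "'a::real_normed_vector set"
  assumes "\<And>x e. x \<in> A \<Longrightarrow> 0 < e \<Longrightarrow> \<exists>y\<in>C. norm (x - y) \<le> d + e"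
    and "\<And>y e. y \<in> C \<Longrightarrow> 0 < e \<Longrightarrow> \<exists>x\<in>A. norm (y - x) \<le> d + e"
    and "0 \<le> d"
  shows "hausdorff_distance A C \<le> ennreal d"
proof -
  have one_sided: "(INF y\<in>Y. ennreal (norm (x - y))) \<le> ennreal d"
    if near: "\<And>e. 0 < e \<Longrightarrow> \<exists>y\<in>Y. norm (x - y) \<le> d + e" for x and Y :: "'a set"
  proof (rule ennreal_le_epsilon)
    fix e :: real
    assume "0 < e"
    then obtain y where "y \<in> Y" "norm (x - y) \<le> d + e"
      using near by blast
    then show "(INF y\<in>Y. ennreal (norm (x - y))) \<le> ennreal d + ennreal e"
      using \<open>0 < e\<close> \<open>0 \<le> d\<close> by (intro INF_lower2[of y]) (auto simp flip: ennreal_plus intro!: ennreal_leI)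
  qed
  show ?thesis
    unfolding hausdorff_distance_def
    using one_sided[of C] one_sided[of A] assms(1,2)
    by (auto intro!: SUP_least simp: norm_minus_commute)
qed

text \<open>A point of the closure lies within \<open>e\<close> of some \<open>a + c\<close>.
  Keeping \<open>a\<close> and moving only \<open>c\<close> costs at most \<open>d\<close>, whatever
  the set \<open>A\<close> is, even if it is unbounded or empty.\<close>

lemma closed_minkowski_sum_near:
  fixes A C C' :: "'a::real_normed_vector set"
  assumes near: "\<And>c. c \<in> C \<Longrightarrow> \<exists>c'\<in>C'. norm (c - c') \<le> d"
    and x: "x \<in> A \<oplus>\<^sub>M C" and "0 < e"
  shows "\<exists>y \<in> A \<oplus>\<^sub>M C'. norm (x - y) \<le> d + e"
proof -
  obtain z where z: "z \<in> A + C" "dist z x < e"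
    using x \<open>0 < e\<close> unfolding closed_minkowski_sum_def closure_approachable by blast
  then obtain a c where ac: "a \<in> A" "c \<in> C" "dist (a + c) x < e"
    by (auto elim: set_plus_elim)
  obtain c' where c': "c' \<in> C'" "norm (c - c') \<le> d"
    using near ac(2) by blast
  have "a + c' \<in> A \<oplus>\<^sub>M C'"
    unfolding closed_minkowski_sum_def by (rule subsetD[OF closure_subset set_plus_intro[OF ac(1) c'(1)]])
  \<comment> \<open>Here \<open>a\<close> cancels: \<open>x - (a + c')\<close> is the sum of
    \<open>x - (a + c)\<close> and \<open>c - c'\<close>.\<close>
  moreover have "norm (x - (a + c')) \<le> norm (x - (a + c)) + norm (c - c')"
    using norm_triangle_ineq[of "x - (a + c)" "c - c'"] by (simp add: algebra_simps)
  ultimately show ?thesis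
    using ac(3) c'(2) by (intro bexI[of _ "a + c'"]) (auto simp: dist_norm norm_minus_commute)
qed

text \<open>The difference is the integral over the gap between \<open>a\<close> and
  \<open>b\<close>, where the integrand has norm at most \<open>c\<close>. The bound is only almost
  everywhere because selections are constrained only there.\<close>

lemma set_lebesgue_integral_lower_limit_diff:
  fixes g :: "real \<Rightarrow> 'a::{banach,second_countable_topology}"
  assumes "set_integrable lebesgue {t0..T} g"
    and bound: "AE x in lebesgue. x \<in> {t0..T} \<longrightarrow> norm (g x) \<le> c"
    and "t0 \<le> a" "a \<le> b" "b \<le> t" "t \<le> T"
  shows "norm (set_lebesgue_integral lebesgue {a..t} g - set_lebesgue_integral lebesgue {b..t} g)
    \<le> c * (b - a)"
proof -
  have int: "set_integrable lebesgue {a..<b} g" "set_integrable lebesgue {b..t} g"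
    using assms by (auto intro!: set_integrable_subset[OF assms(1)])
  \<comment> \<open>The first piece is half-open so that the union is disjoint and the integral is
    additive.\<close>
  have "{a..t} = {a..<b} \<union> {b..t}"
    using assms by auto
  then have "set_lebesgue_integral lebesgue {a..t} g - set_lebesgue_integral lebesgue {b..t} g
      = set_lebesgue_integral lebesgue {a..<b} g"
    using set_integral_Un[OF _ int] by (auto simp: Int_def)
  also have "norm \<dots> \<le> (\<integral>x. norm (indicator {a..<b} x *\<^sub>R g x) \<partial>lebesgue)"
    unfolding set_lebesgue_integral_def by (rule integral_norm_bound)
  also have "\<dots> \<le> (\<integral>x. indicator {a..<b} x * c \<partial>lebesgue)"
  proof (rule integral_mono_AE)
    show "integrable lebesgue (\<lambda>x. norm (indicator {a..<b} x *\<^sub>R g x))"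
      using int(1) unfolding set_integrable_def by (rule integrable_norm)
    show "integrable lebesgue (\<lambda>x. indicator {a..<b} x * c)"
      by (intro integrable_mult_left integrable_real_indicator) (use \<open>a \<le> b\<close> in auto)
    show "AE x in lebesgue. norm (indicator {a..<b} x *\<^sub>R g x) \<le> indicator {a..<b} x * c"
      using bound by eventually_elim (use assms in \<open>auto simp: indicator_def\<close>)
  qed
  also have "\<dots> = c * (b - a)"
    using \<open>a \<le> b\<close> by simp
  finally show ?thesis .
qed

text \<open>Selections live on all of \<open>{t0..T}\<close>, so the \<open>g\<close> that witnesses
  a point of one integral also yields a point of the other. The free bound \<open>d\<close> lets one
  value serve all steps of a partition.\<close>

lemma aumann_integral_lower_limit_near:
  fixes \<Gamma> :: "real \<Rightarrow> 'a::{banach,second_countable_topology} set"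
  assumes bound: "\<And>\<tau> x. \<tau> \<in> {t0..T} \<Longrightarrow> x \<in> \<Gamma> \<tau> \<Longrightarrow> norm x \<le> c"
    and ab: "t0 \<le> a" "a \<le> b" "b \<le> t" "t \<le> T" and "c * (b - a) \<le> d"
  shows "y \<in> aumann_integral t0 T b t \<Gamma> \<Longrightarrow> \<exists>z\<in>aumann_integral t0 T a t \<Gamma>. norm (y - z) \<le> d"
    and "z \<in> aumann_integral t0 T a t \<Gamma> \<Longrightarrow> \<exists>y\<in>aumann_integral t0 T b t \<Gamma>. norm (z - y) \<le> d"
proof -
  have diff: "norm (set_lebesgue_integral lebesgue {a..t} g - set_lebesgue_integral lebesgue {b..t} g) \<le> d"
    if "set_integrable lebesgue {t0..T} g" "AE \<tau> in lebesgue. \<tau> \<in> {t0..T} \<longrightarrow> g \<tau> \<in> \<Gamma> \<tau>" for g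
  proof -
    have "AE \<tau> in lebesgue. \<tau> \<in> {t0..T} \<longrightarrow> norm (g \<tau>) \<le> c"
      using that(2) by eventually_elim (use bound in auto)
    from set_lebesgue_integral_lower_limit_diff[OF that(1) this ab] \<open>c * (b - a) \<le> d\<close>
    show ?thesis by simp
  qed
  show "\<exists>z\<in>aumann_integral t0 T a t \<Gamma>. norm (y - z) \<le> d" if "y \<in> aumann_integral t0 T b t \<Gamma>"
    using that diff unfolding aumann_integral_def by (fastforce simp: norm_minus_commute)
  show "\<exists>y\<in>aumann_integral t0 T b t \<Gamma>. norm (z - y) \<le> d" if "z \<in> aumann_integral t0 T a t \<Gamma>"
    using that diff unfolding aumann_integral_def by fastforce
qed

lemma partition_of_mono:
  assumes "partition_of a b n p" "i \<le> k" "k \<le> n"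
  shows "p i \<le> p k"
  using assms(2,3)
proof (induction k rule: dec_induct)
  case (step k)
  then have "p (Suc k - 1) < p (Suc k)"
    using assms(1) unfolding partition_of_def by (metis atLeastAtMost_iff le_add1 plus_1_eq_Suc)
  with step show ?case by simp
qed simp

lemma partition_of_bounds:
  assumes "partition_of a b n p" "i \<le> n"
  shows "a \<le> p i" "p i \<le> b"
  using partition_of_mono[OF assms(1), of 0 i] partition_of_mono[OF assms(1), of i n] assms
  by (auto simp: partition_of_def)

lemma partition_of_step_le_mesh:
  assumes "i \<in> {1..n}"
  shows "p i - p (i - 1) \<le> mesh n p"
  using assms by (auto simp: mesh_def intro!: Max_ge)

lemma partition_of_mesh_nonneg:
  assumes "partition_of a b n p"
  shows "0 \<le> mesh n p"
proof (cases "n = 0")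
  case False
  \<comment> \<open>Any single step bounds the mesh from below; the first one exists because
    \<open>n\<close> is nonzero.\<close>
  then have "0 \<le> p 1 - p (1 - 1)" "p 1 - p (1 - 1) \<le> mesh n p"
    using partition_of_mono[OF assms, of 0 1] partition_of_step_le_mesh[of 1 n p] by auto
  then show ?thesis by linarith
qed (simp add: mesh_def)

text \<open>Both sums are unions over the same indices, so a point is matched within the piece of
  its own index, at cost at most \<open>c\<close> times that step. The mesh makes this uniform in
  the index.\<close>

lemma hausdorff_distance_lower_upper_sum_le:
  fixes G :: "real \<Rightarrow> 'a::{banach,second_countable_topology} set"
  assumes bound: "\<And>\<tau> x. \<tau> \<in> {t0..T} \<Longrightarrow> x \<in> G \<tau> \<Longrightarrow> norm x \<le> c"
    and "0 \<le> c" "t \<le> T" and p: "partition_of t0 t n p"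
  shows "hausdorff_distance (lower_sum t0 T B G t n p) (upper_sum t0 T B G t n p)
    \<le> ennreal (c * mesh n p)"
proof -
  define d where "d = c * mesh n p"
  have "0 \<le> d"
    using \<open>0 \<le> c\<close> partition_of_mesh_nonneg[OF p] by (simp add: d_def)
  define I where "I s = aumann_integral t0 T s t G" for s
  define D where "D = nucleation_increment B p"
  have lower: "lower_sum t0 T B G t n p = (B t0 \<oplus>\<^sub>M I t0) \<union> (\<Union>i\<in>{1..n}. D i \<oplus>\<^sub>M I (p i))"
    and upper: "upper_sum t0 T B G t n p = (B t0 \<oplus>\<^sub>M I t0) \<union> (\<Union>i\<in>{1..n}. D i \<oplus>\<^sub>M I (p (i - 1)))"
    by (simp_all add: lower_sum_def upper_sum_def I_def D_def)
  have step: "t0 \<le> p (i - 1)" "p (i - 1) \<le> p i" "p i \<le> t" "c * (p i - p (i - 1)) \<le> d"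
    if "i \<in> {1..n}" for i
    using that \<open>0 \<le> c\<close> partition_of_bounds[OF p, of "i - 1"] partition_of_bounds[OF p, of i]
      partition_of_mono[OF p, of "i - 1" i] partition_of_step_le_mesh[OF that, of p]
    by (auto simp: d_def intro!: mult_left_mono)
  have near: "\<exists>y\<in>D i \<oplus>\<^sub>M I (p (i - 1)). norm (x - y) \<le> d + e"
    if "i \<in> {1..n}" "x \<in> D i \<oplus>\<^sub>M I (p i)" "0 < e" for i x e
  proof (rule closed_minkowski_sum_near[OF _ that(2,3)])
    show "\<exists>z\<in>I (p (i - 1)). norm (y - z) \<le> d" if "y \<in> I (p i)" for y
      using that step[OF \<open>i \<in> {1..n}\<close>] bound \<open>t \<le> T\<close> unfolding I_def
      by (intro aumann_integral_lower_limit_near(1)[where c = c and b = "p i"])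
  qed
  have near': "\<exists>y\<in>D i \<oplus>\<^sub>M I (p i). norm (x - y) \<le> d + e"
    if "i \<in> {1..n}" "x \<in> D i \<oplus>\<^sub>M I (p (i - 1))" "0 < e" for i x e
  proof (rule closed_minkowski_sum_near[OF _ that(2,3)])
    show "\<exists>y\<in>I (p i). norm (z - y) \<le> d" if "z \<in> I (p (i - 1))" for z
      using that step[OF \<open>i \<in> {1..n}\<close>] bound \<open>t \<le> T\<close> unfolding I_def
      by (intro aumann_integral_lower_limit_near(2)[where c = c and a = "p (i - 1)"])
  qed
  \<comment> \<open>The families \<open>X\<close> and \<open>Y\<close> stay arbitrary so that the
    same fact serves both directions of the Hausdorff distance.\<close>
  have union_near: "\<exists>y\<in>(B t0 \<oplus>\<^sub>M I t0) \<union> (\<Union>i\<in>{1..n}. Y i). norm (x - y) \<le> d + e"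
    if "x \<in> (B t0 \<oplus>\<^sub>M I t0) \<union> (\<Union>i\<in>{1..n}. X i)" "0 < e"
      and "\<And>i. i \<in> {1..n} \<Longrightarrow> x \<in> X i \<Longrightarrow> \<exists>y\<in>Y i. norm (x - y) \<le> d + e"
    for X Y :: "nat \<Rightarrow> 'a set" and x e
  proof (cases "x \<in> B t0 \<oplus>\<^sub>M I t0")
    case True
    then show ?thesis
      \<comment> \<open>The piece coming from \<open>B t0\<close> belongs to both unions, so
        \<open>x\<close> is matched with itself at distance 0.\<close>
      using \<open>0 < e\<close> \<open>0 \<le> d\<close> by (intro bexI[of _ x]) auto
  next
    case False
    with that show ?thesis by blast
  qed
  show ?thesis
    unfolding lower upper d_def[symmetric]
    by (intro hausdorff_distance_le \<open>0 \<le> d\<close>; erule (1) union_near) (rule near near'; assumption)+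
qed

theorem proposition4p5:
  fixes M :: "'w measure" and F :: "real \<Rightarrow> 'w measure" and t0 T t :: real
    and B G :: "'w \<Rightarrow> real \<Rightarrow> 'a::{banach,second_countable_topology} set"
    and n :: "nat \<Rightarrow> nat" and p :: "nat \<Rightarrow> nat \<Rightarrow> real"
  assumes "reflexive_space TYPE('a)"
    and "separable_dual TYPE('a)"
    and "filtered_prob_space M F t0 T"
    and "nucleation_process M F t0 T B"
    and "growth_process M F t0 T G"
    and "t \<in> {t0..T}"
    and "refinement_sequence t0 t n p"
  shows "AE \<omega> in M.
    (\<lambda>j. hausdorff_distance (lower_sum t0 T (B \<omega>) (G \<omega>) t (n j) (p j))
                            (upper_sum t0 T (B \<omega>) (G \<omega>) t (n j) (p j))) \<longlonglongrightarrow> 0"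
proof (rule AE_I2)
  fix \<omega>
  assume \<omega>: "\<omega> \<in> space M"
  obtain K where K: "bounded K" "\<And>\<tau>. \<tau> \<in> {t0..T} \<Longrightarrow> G \<omega> \<tau> \<subseteq> K"
    using assms(5) \<omega> unfolding growth_process_def by blast
  \<comment> \<open>This \<open>c\<close> does not vary with \<open>j\<close>, so the bound
    \<open>c * mesh (n j) (p j)\<close> tends to 0 with the mesh.\<close>
  then obtain c where c: "0 < c" "\<And>x. x \<in> K \<Longrightarrow> norm x \<le> c"
    by (auto simp: bounded_pos)
  have p: "partition_of t0 t (n j) (p j)" for j
    using assms(7) by (auto simp: refinement_sequence_def)
  have mesh: "(\<lambda>j. mesh (n j) (p j)) \<longlonglongrightarrow> 0"
    using assms(7) by (auto simp: refinement_sequence_def)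
  have "(\<lambda>j. ennreal (c * mesh (n j) (p j))) \<longlonglongrightarrow> ennreal (c * 0)"
    by (intro tendsto_ennrealI tendsto_mult_left mesh)
  then have upper_bound: "(\<lambda>j. ennreal (c * mesh (n j) (p j))) \<longlonglongrightarrow> 0"
    by simp
  have "hausdorff_distance (lower_sum t0 T (B \<omega>) (G \<omega>) t (n j) (p j))
      (upper_sum t0 T (B \<omega>) (G \<omega>) t (n j) (p j)) \<le> ennreal (c * mesh (n j) (p j))" for j
    using K(2) c assms(6) by (intro hausdorff_distance_lower_upper_sum_le p) auto
  then show "(\<lambda>j. hausdorff_distance (lower_sum t0 T (B \<omega>) (G \<omega>) t (n j) (p j))
      (upper_sum t0 T (B \<omega>) (G \<omega>) t (n j) (p j))) \<longlonglongrightarrow> 0"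
    \<comment> \<open>The distance is squeezed between the constant 0 and
      \<open>upper_bound\<close>; values in \<open>ennreal\<close> are nonnegative.\<close>
    by (intro tendsto_sandwich[OF _ _ tendsto_const upper_bound]) auto
qed

end
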